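(* Let $K$ be a field, $n\ge 1$, and let $\tau\colon K[x_1,\ldots,x_n]\to K[x_1,\ldots,x_n]$ be a $K$-algebra endomorphism having a large image. If the Jacobian $J(\tau)=\det\left(\partial \tau(x_i)/\partial x_j\right)_{1\le i,j\le n}$ belongs to $K^*=K\setminus\{0\}$, then $\tau$ is an automorphism.
   Context: For a ring $R$, an endomorphism $\sigma$ of $R$ has a large image if $\sigma(R)$ contains an essential left ideal $L$ of $R$ whose right annihilator $\{a\in R\mid La=0\}$ is zero. For $R=K[x_1,\ldots,x_n]$ this means that $\tau(R)$ contains a nonzero ideal of $R$. *)

theory Defs
  imports "HOL-Analysis.Determinants" "HOL-Library.Poly_Mapping"
begin

text \<open>
  The polynomial ring over \<^typ>\<open>'k\<close> in variables indexed by the finite type \<^typ>\<open>'n\<close>: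
  finitely supported functions from exponent vectors to coefficients, with convolution as
  product. As types are nonempty, \<^term>\<open>CARD('n)\<close> is an arbitrary integer at least 1.
\<close>

type_synonym ('n, 'k) mpoly = "('n \<Rightarrow>\<^sub>0 nat) \<Rightarrow>\<^sub>0 'k"

definition Var :: "'n \<Rightarrow> ('n, 'k::zero_neq_one) mpoly" where
  "Var i = Poly_Mapping.single (Poly_Mapping.single i 1) 1"

definition Const :: "'k \<Rightarrow> ('n, 'k::zero) mpoly" where
  "Const c = Poly_Mapping.single 0 c"

text \<open>
  For \<open>lookup m j = 0\<close> the exponent \<open>m - e\<^sub>j\<close> is truncated, but its coefficient is \<open>0\<close>.
\<close>

definition partial_deriv :: "'n \<Rightarrow> ('n, 'k::comm_ring_1) mpoly \<Rightarrow> ('n, 'k) mpoly" where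
  "partial_deriv j p =
     (\<Sum>m\<in>Poly_Mapping.keys p.
        Poly_Mapping.single (m - Poly_Mapping.single j 1)
          (of_nat (Poly_Mapping.lookup m j) * Poly_Mapping.lookup p m))"

definition jacobian ::
    "(('n::finite, 'k::comm_ring_1) mpoly \<Rightarrow> ('n, 'k) mpoly) \<Rightarrow> ('n, 'k) mpoly" where
  "jacobian \<tau> = det (\<chi> i j. partial_deriv j (\<tau> (Var i)))"

definition ring_endo :: "('r::ring_1 \<Rightarrow> 'r) \<Rightarrow> bool" where
  "ring_endo \<sigma> \<longleftrightarrow> (\<forall>a b. \<sigma> (a + b) = \<sigma> a + \<sigma> b) \<and> (\<forall>a b. \<sigma> (a * b) = \<sigma> a * \<sigma> b) \<and> \<sigma> 1 = 1"

definition alg_endo :: "(('n, 'k::comm_ring_1) mpoly \<Rightarrow> ('n, 'k) mpoly) \<Rightarrow> bool" where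
  "alg_endo \<tau> \<longleftrightarrow> ring_endo \<tau> \<and> (\<forall>c. \<tau> (Const c) = Const c)"

definition alg_auto :: "(('n, 'k::comm_ring_1) mpoly \<Rightarrow> ('n, 'k) mpoly) \<Rightarrow> bool" where
  "alg_auto \<tau> \<longleftrightarrow> alg_endo \<tau> \<and> bij \<tau>"

definition left_ideal :: "'r::ring_1 set \<Rightarrow> bool" where
  "left_ideal L \<longleftrightarrow> 0 \<in> L \<and> (\<forall>a\<in>L. \<forall>b\<in>L. a + b \<in> L) \<and> (\<forall>r. \<forall>a\<in>L. r * a \<in> L)"

definition essential_left_ideal :: "'r::ring_1 set \<Rightarrow> bool" where
  "essential_left_ideal L \<longleftrightarrow>
     left_ideal L \<and> (\<forall>J. left_ideal J \<and> J \<noteq> {0} \<longrightarrow> L \<inter> J \<noteq> {0})"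

definition right_annihilator :: "'r::ring_1 set \<Rightarrow> 'r set" where
  "right_annihilator L = {a. \<forall>l\<in>L. l * a = 0}"

definition large_image :: "('r::ring_1 \<Rightarrow> 'r) \<Rightarrow> bool" where
  "large_image \<sigma> \<longleftrightarrow>
     (\<exists>L. L \<subseteq> range \<sigma> \<and> essential_left_ideal L \<and> right_annihilator L = {0})"

end

theory Submission
  imports Defs "HOL-Computational_Algebra.Primes"
begin

text \<open>
  Write \<open>F\<^sub>i = \<tau> (Var i)\<close>, \<open>A\<close> for the polynomial ring and \<open>B = K[F\<^sub>1, \<dots>, F\<^sub>n]\<close> for the image
  of \<open>\<tau>\<close>. The idea is to look at the conductor: the polynomials \<open>f\<close> with \<open>\<tau> f \<cdot> A \<subseteq> B\<close>. A large
  image makes it nonzero (\<open>ex_nonzero_conductor\<close>), and \<open>\<tau>\<close> is surjective as soon as it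
  contains a nonzero constant. Constants are reached by lowering degrees inside the conductor.

  Because the Jacobian is a unit, the derivations \<open>\<partial>/\<partial>F\<^sub>i\<close> of \<open>B\<close> are restrictions of derivations of \<open>A\<close>
  (\<open>jacobian_deriv_alg_endo\<close>), and the product rule shows that the conductor is stable
  under all partial derivatives (\<open>conductor_partial_deriv\<close>). In characteristic 0 this
  already suffices: differentiate a nonzero element until a nonzero constant is left.

  In characteristic \<open>p > 0\<close> the process may stop at a polynomial in \<open>x\<^sub>1\<^sup>p, \<dots>, x\<^sub>n\<^sup>p\<close>. Then a
  \<open>p\<close>-th root is taken, in the form of a Cartier operator: an additive map
  \<open>\<Pi>\<close> of \<open>A\<close> with \<open>\<Pi>(a\<^sup>p f) = a \<Pi>(f)\<close>, which divides exponents by \<open>p\<close> and commutes with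
  \<open>\<tau>\<close> on polynomials with zero gradient (\<open>cartier_alg_endo\<close>). The conductor is stable
  under this too (\<open>conductor_cartier\<close>), so the degree can always be lowered
  (\<open>ex_Const_in_stable_set\<close>).

  The kernel of \<open>\<tau>\<close> has the same two stability properties. If it were nonzero it would contain a
  nonzero constant, which \<open>\<tau>\<close> fixes; hence \<open>\<tau>\<close> is injective (\<open>inj_of_Const_jacobian\<close>).
\<close>

section \<open>Polynomials, their induction principles and partial derivatives\<close>

lemma poly_mapping_eq_sum_single:
  "f = (\<Sum>m\<in>Poly_Mapping.keys f. Poly_Mapping.single m (Poly_Mapping.lookup f m))"
proof (rule poly_mapping_eqI)
  fix k
  show "Poly_Mapping.lookup f k = Poly_Mapping.lookup
     (\<Sum>m\<in>Poly_Mapping.keys f. Poly_Mapping.single m (Poly_Mapping.lookup f m)) k"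
    by (simp add: lookup_sum lookup_single when_def in_keys_iff)
qed

lemma poly_mapping_add_induct [case_names zero single add]:
  fixes f :: "'a \<Rightarrow>\<^sub>0 'b::comm_monoid_add"
  assumes "P 0" and "\<And>m c. P (Poly_Mapping.single m c)" and "\<And>f g. P f \<Longrightarrow> P g \<Longrightarrow> P (f + g)"
  shows "P f"
proof -
  have "P (\<Sum>m\<in>A. Poly_Mapping.single m (Poly_Mapping.lookup f m))" if "finite A" for A
    using that by (induction A) (auto intro: assms)
  then show ?thesis
    by (subst poly_mapping_eq_sum_single) simp
qed

lemma exponent_induct [case_names zero unit add]:
  fixes m :: "'n \<Rightarrow>\<^sub>0 nat"
  assumes "P 0" and "\<And>i. P (Poly_Mapping.single i 1)" and "\<And>a b. P a \<Longrightarrow> P b \<Longrightarrow> P (a + b)"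
  shows "P m"
proof (induction m rule: poly_mapping_add_induct)
  case (single i k)
  show ?case
  proof (induction k)
    case (Suc k)
    then show ?case
      using assms(3)[OF assms(2)[of i] Suc] by (simp flip: single_add)
  qed (simp add: assms(1))
qed (use assms in auto)

lemma mpoly_induct [case_names Const Var add mult]:
  fixes f :: "('n, 'k::comm_ring_1) mpoly"
  assumes "\<And>c. P (Const c)" and "\<And>i. P (Var i)"
    and "\<And>f g. P f \<Longrightarrow> P g \<Longrightarrow> P (f + g)" and "\<And>f g. P f \<Longrightarrow> P g \<Longrightarrow> P (f * g)"
  shows "P f"
proof (induction f rule: poly_mapping_add_induct)
  case zero
  show ?case using assms(1)[of 0] by (simp add: Const_def)
next
  case (single m c)
  have 1: "P (Poly_Mapping.single m 1)"
  proof (induction m rule: exponent_induct)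
    case zero
    show ?case using assms(1)[of 1] by (simp add: Const_def)
  next
    case (unit i)
    show ?case using assms(2)[of i] by (simp add: Var_def)
  next
    case (add a b)
    show ?case using assms(4)[OF add] by (simp add: mult_single)
  qed
  show ?case using assms(4)[OF assms(1)[of c] 1] by (simp add: Const_def mult_single)
qed (use assms in auto)

lemma Const_mult: "Const a * Const b = (Const (a * b) :: ('n, 'k::comm_ring_1) mpoly)"
  by (simp add: Const_def mult_single)

lemma Const_1: "Const 1 = (1 :: ('n, 'k::comm_ring_1) mpoly)"
  by (simp add: Const_def)

lemma Const_inverse_cancel:
  fixes x :: "('n, 'k::field) mpoly"
  assumes "c \<noteq> 0"
  shows "Const (inverse c) * (x * Const c) = x"
proof -
  have "Const (inverse c) * (x * Const c) = x * (Const (inverse c) * Const c)"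
    by (rule mult.left_commute)
  then show ?thesis using assms by (simp add: Const_mult Const_1)
qed

lemma partial_deriv_eq_sum:
  assumes "finite A" and "Poly_Mapping.keys p \<subseteq> A"
  shows "partial_deriv j p = (\<Sum>m\<in>A. Poly_Mapping.single (m - Poly_Mapping.single j 1)
          (of_nat (Poly_Mapping.lookup m j) * Poly_Mapping.lookup p m))"
  unfolding partial_deriv_def
  by (rule sum.mono_neutral_left) (use assms in \<open>auto simp: in_keys_iff\<close>)

lemma partial_deriv_single:
  "partial_deriv j (Poly_Mapping.single m c) =
     Poly_Mapping.single (m - Poly_Mapping.single j 1) (of_nat (Poly_Mapping.lookup m j) * c)"
  by (subst partial_deriv_eq_sum[of "{m}"]) auto

lemma partial_deriv_0 [simp]: "partial_deriv j 0 = 0"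
  by (simp add: partial_deriv_def)

lemma partial_deriv_add: "partial_deriv j (p + q) = partial_deriv j p + partial_deriv j q"
proof -
  let ?A = "Poly_Mapping.keys p \<union> Poly_Mapping.keys q"
  have "Poly_Mapping.keys (p + q) \<subseteq> ?A" by (rule keys_add)
  then show ?thesis
    by (simp add: partial_deriv_eq_sum[of ?A] lookup_add distrib_left single_add sum.distrib)
qed

lemma lookup_partial_deriv:
  "Poly_Mapping.lookup (partial_deriv j f) m =
     of_nat (Suc (Poly_Mapping.lookup m j)) * Poly_Mapping.lookup f (m + Poly_Mapping.single j 1)"
proof (induction f rule: poly_mapping_add_induct)
  case (single k c)
  show ?case
  proof (cases "k = m + Poly_Mapping.single j 1")
    case True
    then show ?thesis
      by (simp add: partial_deriv_single lookup_add)
  next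
    case False
    have "k = m + Poly_Mapping.single j 1"
      if "k - Poly_Mapping.single j 1 = m" "Poly_Mapping.lookup k j \<noteq> 0"
      using that
      by (intro poly_mapping_eqI)
         (auto simp: lookup_add lookup_minus lookup_single when_def)
    with False have "k - Poly_Mapping.single j 1 \<noteq> m \<or> Poly_Mapping.lookup k j = 0"
      by blast
    with False show ?thesis
      by (auto simp: partial_deriv_single lookup_single when_def)
  qed
qed (simp_all add: partial_deriv_add lookup_add distrib_left)

lemma partial_deriv_mult:
  "partial_deriv j (p * q) = p * partial_deriv j q + q * partial_deriv j p"
proof (induction p rule: poly_mapping_add_induct)
  case (single m c)
  show ?case
  proof (induction q rule: poly_mapping_add_induct)
    case (single k d)
    let ?e = "Poly_Mapping.single j (1::nat)"
    have eq: "u + (v - ?e) = u + v - ?e" if "Poly_Mapping.lookup v j \<noteq> 0" for u v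
      by (rule poly_mapping_eqI)
         (use that in \<open>auto simp: lookup_add lookup_minus lookup_single when_def\<close>)
    have 1: "Poly_Mapping.single m c * partial_deriv j (Poly_Mapping.single k d) =
        Poly_Mapping.single (m + k - ?e) (of_nat (Poly_Mapping.lookup k j) * (c * d))"
      by (cases "Poly_Mapping.lookup k j = 0")
         (auto simp: partial_deriv_single mult_single eq mult_ac simp del: One_nat_def)
    have 2: "Poly_Mapping.single k d * partial_deriv j (Poly_Mapping.single m c) =
        Poly_Mapping.single (m + k - ?e) (of_nat (Poly_Mapping.lookup m j) * (c * d))"
      by (cases "Poly_Mapping.lookup m j = 0")
         (auto simp: partial_deriv_single mult_single eq mult_ac add.commute simp del: One_nat_def)
    show ?case
      unfolding 1 2
      by (simp add: mult_single partial_deriv_single lookup_add distrib_right add.commute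
          flip: single_add)
  qed (simp_all add: partial_deriv_add algebra_simps)
qed (simp_all add: partial_deriv_add algebra_simps)

lemma partial_deriv_Const [simp]: "partial_deriv j (Const c) = 0"
  by (simp add: Const_def partial_deriv_single)

lemma partial_deriv_Var: "partial_deriv j (Var i) = (if i = j then 1 else 0)"
  by (auto simp: Var_def partial_deriv_single lookup_single)

lemma partial_deriv_power:
  "partial_deriv j (a ^ n) = of_nat n * a ^ (n - 1) * partial_deriv j a"
proof (induction n)
  case 0
  show ?case by (simp flip: Const_1)
next
  case (Suc n)
  then show ?case
    by (cases n) (simp_all add: partial_deriv_mult algebra_simps)
qed

section \<open>Chain rule and Jacobian derivations\<close>

lemma alg_endoD:
  assumes "alg_endo \<tau>"
  shows "\<tau> (a + b) = \<tau> a + \<tau> b" and "\<tau> (a * b) = \<tau> a * \<tau> b"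
    and "\<tau> 1 = 1" and "\<tau> (Const c) = Const c" and "\<tau> 0 = 0"
    and "\<tau> (a - b) = \<tau> a - \<tau> b" and "\<tau> (a ^ n) = \<tau> a ^ n"
    and "\<tau> (sum g A) = (\<Sum>x\<in>A. \<tau> (g x))"
proof -
  show add: "\<tau> (a + b) = \<tau> a + \<tau> b" and mult: "\<tau> (a * b) = \<tau> a * \<tau> b"
    and one: "\<tau> 1 = 1" and "\<tau> (Const c) = Const c" for a b
    using assms by (auto simp: alg_endo_def ring_endo_def)
  show zero: "\<tau> 0 = 0" using add[of 0 0] by simp
  show "\<tau> (a - b) = \<tau> a - \<tau> b" using add[of "a - b" b] by simp
  show "\<tau> (a ^ n) = \<tau> a ^ n" by (induction n) (simp_all add: one mult)
  show "\<tau> (sum g A) = (\<Sum>x\<in>A. \<tau> (g x))"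
    by (induction A rule: infinite_finite_induct) (simp_all add: zero add)
qed

text \<open>Both sides are derivations along \<open>\<tau>\<close> that agree on the constants and the variables.\<close>

lemma partial_deriv_alg_endo:
  fixes \<tau> :: "('n::finite, 'k::comm_ring_1) mpoly \<Rightarrow> ('n, 'k) mpoly"
  assumes "alg_endo \<tau>"
  shows "partial_deriv j (\<tau> f) = (\<Sum>k\<in>UNIV. \<tau> (partial_deriv k f) * partial_deriv j (\<tau> (Var k)))"
proof (induction f rule: mpoly_induct)
  case (Const c)
  show ?case by (simp add: alg_endoD[OF assms])
next
  case (Var i)
  have "\<tau> (partial_deriv k (Var i)) = (if i = k then 1 else 0)" for k
    by (simp add: partial_deriv_Var alg_endoD[OF assms])
  then show ?case by (simp add: if_distrib[of "\<lambda>x. x * _"] cong: if_cong)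
next
  case (add f g)
  then show ?case
    by (simp add: alg_endoD[OF assms] partial_deriv_add distrib_right sum.distrib)
next
  case (mult f g)
  then show ?case
    by (simp add: alg_endoD[OF assms] partial_deriv_mult distrib_right sum.distrib
        sum_distrib_left mult.assoc)
qed

text \<open>
  Up to the factor \<^term>\<open>jacobian \<tau>\<close> this is the derivation \<open>\<partial>/\<partial>F\<^sub>i\<close> for
  \<open>F\<^sub>k = \<tau> (Var k)\<close>; writing it as a determinant, with the \<open>i\<close>-th gradient replaced by
  that of the argument, makes the inverse of the Jacobian matrix superfluous.
\<close>

definition jacobian_deriv ::
    "(('n::finite, 'k::comm_ring_1) mpoly \<Rightarrow> ('n, 'k) mpoly) \<Rightarrow> 'n \<Rightarrow> ('n, 'k) mpoly \<Rightarrow> ('n, 'k) mpoly"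
  where "jacobian_deriv \<tau> i a =
    det (\<chi> k. if k = i then (\<chi> j. partial_deriv j a) else (\<chi> j. partial_deriv j (\<tau> (Var k))))"

lemma jacobian_deriv_mult:
  "jacobian_deriv \<tau> i (a * b) = a * jacobian_deriv \<tau> i b + b * jacobian_deriv \<tau> i a"
proof -
  have "(\<chi> j. partial_deriv j (a * b)) = a *s (\<chi> j. partial_deriv j b) + b *s (\<chi> j. partial_deriv j a)"
    by (simp add: vec_eq_iff partial_deriv_mult)
  then show ?thesis
    by (simp only: jacobian_deriv_def det_row_add det_row_mul)
qed

lemma jacobian_deriv_eq_0:
  assumes "\<And>j. partial_deriv j a = 0"
  shows "jacobian_deriv \<tau> i a = 0"
proof -
  have "(\<chi> j. partial_deriv j a) = 0" by (simp add: vec_eq_iff assms)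
  then show ?thesis by (simp only: jacobian_deriv_def det_row_0)
qed

text \<open>
  By the chain rule the gradient of \<^term>\<open>\<tau> f\<close> is a combination of the rows of the Jacobian
  matrix; only its \<open>i\<close>-th term survives in the alternating determinant.
\<close>

lemma jacobian_deriv_alg_endo:
  fixes \<tau> :: "('n::finite, 'k::comm_ring_1) mpoly \<Rightarrow> ('n, 'k) mpoly"
  assumes "alg_endo \<tau>"
  shows "jacobian_deriv \<tau> i (\<tau> f) = \<tau> (partial_deriv i f) * jacobian \<tau>"
proof -
  define grad where "grad k = (\<chi> j. partial_deriv j (\<tau> (Var k)))" for k
  define minor where "minor v = det (\<chi> k. if k = i then v else grad k)" for v
  have "(\<chi> j. partial_deriv j (\<tau> f)) = (\<Sum>k\<in>UNIV. \<tau> (partial_deriv k f) *s grad k)"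
    by (simp add: vec_eq_iff grad_def partial_deriv_alg_endo[OF assms, of _ f])
  then have "jacobian_deriv \<tau> i (\<tau> f) = minor (\<Sum>k\<in>UNIV. \<tau> (partial_deriv k f) *s grad k)"
    by (simp only: jacobian_deriv_def minor_def grad_def)
  also have "\<dots> = (\<Sum>k\<in>UNIV. \<tau> (partial_deriv k f) * minor (grad k))"
    using det_linear_row_sum[of UNIV i "\<lambda>_ k. \<tau> (partial_deriv k f) *s grad k" grad]
    by (simp add: minor_def det_row_mul)
  also have "\<dots> = (\<Sum>k\<in>UNIV. if k = i then \<tau> (partial_deriv i f) * jacobian \<tau> else 0)"
  proof (rule sum.cong)
    fix k
    show "\<tau> (partial_deriv k f) * minor (grad k) =
        (if k = i then \<tau> (partial_deriv i f) * jacobian \<tau> else 0)"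
    proof (cases "k = i")
      case True
      have "(\<chi> l. if l = i then grad i else grad l) = (\<chi> l j. partial_deriv j (\<tau> (Var l)))"
        by (auto simp: vec_eq_iff grad_def)
      with True show ?thesis by (simp add: minor_def jacobian_def)
    next
      case False
      have "minor (grad k) = 0"
        unfolding minor_def
        by (rule det_identical_rows[OF False]) (use False in \<open>simp add: row_def vec_eq_iff\<close>)
      with False show ?thesis by simp
    qed
  qed simp
  also have "\<dots> = \<tau> (partial_deriv i f) * jacobian \<tau>" by simp
  finally show ?thesis .
qed

section \<open>Cartier operators in positive characteristic\<close>

definition scale_exponent :: "nat \<Rightarrow> ('n \<Rightarrow>\<^sub>0 nat) \<Rightarrow> ('n \<Rightarrow>\<^sub>0 nat)" where
  "scale_exponent p m = Poly_Mapping.map ((*) p) m"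

lemma lookup_scale_exponent [simp]:
  "Poly_Mapping.lookup (scale_exponent p m) i = p * Poly_Mapping.lookup m i"
  by (simp add: scale_exponent_def map.rep_eq when_def)

lemma scale_exponent_add: "scale_exponent p (a + b) = scale_exponent p a + scale_exponent p b"
  by (rule poly_mapping_eqI) (simp add: lookup_add distrib_left)

lemma scale_exponent_0 [simp]: "scale_exponent p 0 = 0"
  by (rule poly_mapping_eqI) simp

lemma inj_scale_exponent: "p > 0 \<Longrightarrow> inj (scale_exponent p)"
  by (rule injI, rule poly_mapping_eqI) (metis lookup_scale_exponent mult_cancel1 less_irrefl)

lemma in_range_scale_exponent_iff:
  assumes "p > 0"
  shows "m \<in> range (scale_exponent p) \<longleftrightarrow> (\<forall>i. p dvd Poly_Mapping.lookup m i)"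
proof
  assume r: "\<forall>i. p dvd Poly_Mapping.lookup m i"
  define m' where "m' = Poly_Mapping.map (\<lambda>x. x div p) m"
  have "Poly_Mapping.lookup m' i = Poly_Mapping.lookup m i div p" for i
    by (simp add: m'_def map.rep_eq when_def)
  with r have "m = scale_exponent p m'"
    by (intro poly_mapping_eqI) simp
  then show "m \<in> range (scale_exponent p)" by blast
qed auto

lemma single_power:
  "Poly_Mapping.single m c ^ p = (Poly_Mapping.single (scale_exponent p m) (c ^ p) :: ('n, 'k::comm_ring_1) mpoly)"
proof (induction p)
  case 0
  have "scale_exponent 0 m = 0" by (rule poly_mapping_eqI) simp
  then show ?case by simp
next
  case (Suc p)
  have "scale_exponent (Suc p) m = m + scale_exponent p m"
    by (rule poly_mapping_eqI) (simp add: lookup_add)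
  with Suc show ?case by (simp add: mult_single)
qed

lemma CHAR_mpoly: "CHAR(('n, 'k::comm_ring_1) mpoly) = CHAR('k)"
proof (rule CHAR_eqI)
  show "of_nat CHAR('k) = (0 :: ('n, 'k) mpoly)"
    by (simp flip: single_of_nat)
next
  fix n assume "of_nat n = (0 :: ('n, 'k) mpoly)"
  then have "Poly_Mapping.lookup (of_nat n :: ('n, 'k) mpoly) 0 = 0" by simp
  then have "of_nat n = (0 :: 'k)" by (simp add: lookup_of_nat)
  then show "CHAR('k) dvd n" by (simp add: of_nat_eq_0_iff_char_dvd)
qed

text \<open>
  A polynomial with vanishing gradient lies in \<open>K[x\<^sub>1\<^sup>p, \<dots>, x\<^sub>n\<^sup>p]\<close>; for \<open>p = 0\<close> the
  divisibility says that it is constant.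
\<close>

lemma keys_dvd_CHAR:
  fixes f :: "('n, 'k::field) mpoly"
  assumes deriv: "\<And>j. partial_deriv j f = 0" and m: "m \<in> Poly_Mapping.keys f"
  shows "CHAR('k) dvd Poly_Mapping.lookup m i"
proof (cases "Poly_Mapping.lookup m i = 0")
  case False
  define m' where "m' = m - Poly_Mapping.single i 1"
  have eq: "m = m' + Poly_Mapping.single i 1"
    by (rule poly_mapping_eqI)
       (use False in \<open>auto simp: m'_def lookup_add lookup_minus lookup_single when_def\<close>)
  have "Poly_Mapping.lookup (partial_deriv i f) m' = 0" by (simp add: deriv)
  then have "of_nat (Poly_Mapping.lookup m i) * Poly_Mapping.lookup f m = 0"
    unfolding lookup_partial_deriv eq[symmetric] by (simp add: eq lookup_add)
  with m show ?thesis by (simp add: in_keys_iff of_nat_eq_0_iff_char_dvd)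
qed simp

locale inverse_frobenius_linear =
  fixes \<pi> :: "'k::field \<Rightarrow> 'k"
  assumes CHAR_pos: "CHAR('k) > 0"
    and additive: "\<pi> (x + y) = \<pi> x + \<pi> y"
    and semilinear: "\<pi> (c ^ CHAR('k) * x) = c * \<pi> x"

text \<open>
  Over an imperfect field the \<open>p\<close>-th root of a coefficient need not exist. Linear algebra
  for the module structure \<open>c \<cdot> x = c\<^sup>p x\<close> provides enough semilinear substitutes.
\<close>

lemma ex_inverse_frobenius_linear:
  fixes a :: "'k::field"
  assumes "CHAR('k) > 0" and "a \<noteq> 0"
  obtains \<pi> :: "'k \<Rightarrow> 'k" where "inverse_frobenius_linear \<pi>" and "\<pi> a \<noteq> 0"
proof -
  define s1 :: "'k \<Rightarrow> 'k \<Rightarrow> 'k" where "s1 = (\<lambda>c x. c ^ CHAR('k) * x)"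
  have "prime CHAR('k)" using assms(1) by (rule prime_CHAR_semidom)
  then have frob: "(x + y) ^ CHAR('k) = x ^ CHAR('k) + y ^ CHAR('k)" for x y :: 'k
    by (simp add: freshmans_dream)
  interpret vector_space_pair s1 "(*) :: 'k \<Rightarrow> 'k \<Rightarrow> 'k"
    by unfold_locales (simp_all add: s1_def frob algebra_simps power_mult_distrib)
  have "vs1.independent {a}" using assms(2) by simp
  from linear_independent_extend[OF this, of "\<lambda>_. 1"] obtain g
    where g: "Vector_Spaces.linear s1 (*) g" and ga: "g a = 1" by auto
  have "inverse_frobenius_linear g"
  proof
    fix x y c :: 'k
    interpret g: Vector_Spaces.linear s1 "(*)" g by (rule g)
    show "g (x + y) = g x + g y" by (rule g.add)
    show "g (c ^ CHAR('k) * x) = c * g x" using g.scale[of c x] by (simp add: s1_def)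
  qed (rule assms(1))
  with ga that show thesis by force
qed

context inverse_frobenius_linear
begin

lemma zero [simp]: "\<pi> 0 = 0"
proof -
  have "\<pi> 0 + \<pi> 0 = \<pi> 0 + 0" using additive[of 0 0] by simp
  then show ?thesis by (simp only: add_left_cancel)
qed

text \<open>
  A substitute for the \<open>p\<close>-th root, with \<open>p\<close> the characteristic: if \<open>\<pi>\<close> fixes \<open>1\<close>, then it
  is a left inverse of the Frobenius map \<open>a \<mapsto> a\<^sup>p\<close>.
\<close>

definition cartier :: "('n, 'k) mpoly \<Rightarrow> ('n, 'k) mpoly" where
  "cartier f =
    Abs_poly_mapping (\<lambda>m. \<pi> (Poly_Mapping.lookup f (scale_exponent CHAR('k) m)))"

lemma lookup_cartier:
  "Poly_Mapping.lookup (cartier f) m = \<pi> (Poly_Mapping.lookup f (scale_exponent CHAR('k) m))"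
proof -
  have "finite (scale_exponent CHAR('k) -` Poly_Mapping.keys f)"
    by (rule finite_vimageI) (simp_all add: inj_scale_exponent CHAR_pos)
  then have "finite {m. \<pi> (Poly_Mapping.lookup f (scale_exponent CHAR('k) m)) \<noteq> 0}"
    by (rule rev_finite_subset) (auto simp: in_keys_iff intro: ccontr)
  then show ?thesis by (simp add: cartier_def)
qed

lemma cartier_0 [simp]: "cartier 0 = 0"
  by (rule poly_mapping_eqI) (simp add: lookup_cartier)

lemma cartier_add: "cartier (f + g) = cartier f + cartier g"
  by (rule poly_mapping_eqI) (simp add: lookup_cartier lookup_add additive)

lemma cartier_sum: "cartier (sum g A) = (\<Sum>x\<in>A. cartier (g x))"
  by (induction A rule: infinite_finite_induct) (simp_all add: cartier_add)

lemma cartier_single_scale: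
  "cartier (Poly_Mapping.single (scale_exponent CHAR('k) m) c) = Poly_Mapping.single m (\<pi> c)"
  by (rule poly_mapping_eqI)
     (auto simp: lookup_cartier lookup_single when_def inj_eq[OF inj_scale_exponent[OF CHAR_pos]])

lemma cartier_single_eq_0:
  "m \<notin> range (scale_exponent CHAR('k)) \<Longrightarrow> cartier (Poly_Mapping.single m c) = 0"
  by (rule poly_mapping_eqI) (auto simp: lookup_cartier lookup_single when_def)

lemma cartier_Const: "cartier (Const c) = Const (\<pi> c)"
  using cartier_single_scale[of 0 c] by (simp add: Const_def)

lemma cartier_power_mult: "cartier (a ^ CHAR('k) * f) = a * cartier f"
proof (induction a rule: poly_mapping_add_induct)
  case zero
  show ?case using CHAR_pos by (simp add: power_0_left)
next
  case (add a b)
  have "prime CHAR('k)" using CHAR_pos by (rule prime_CHAR_semidom)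
  then have "(a + b) ^ CHAR('k) = a ^ CHAR('k) + b ^ CHAR('k)"
    using freshmans_dream[where x = a and y = b] by (simp add: CHAR_mpoly)
  with add show ?case by (simp add: distrib_right cartier_add)
next
  case (single m c)
  let ?p = "CHAR('k)"
  show ?case
  proof (induction f rule: poly_mapping_add_induct)
    case (single k d)
    show ?case
    proof (cases "k \<in> range (scale_exponent ?p)")
      case True
      then obtain k' where k: "k = scale_exponent ?p k'" by blast
      show ?thesis
        by (simp add: k single_power mult_single cartier_single_scale semilinear
            flip: scale_exponent_add)
    next
      case False
      then have "scale_exponent ?p m + k \<notin> range (scale_exponent ?p)"
        by (simp add: in_range_scale_exponent_iff CHAR_pos lookup_add dvd_add_right_iff)
      with False show ?thesis
        by (simp add: single_power mult_single cartier_single_eq_0)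
    qed
  qed (simp_all add: distrib_left cartier_add)
qed

text \<open>
  A polynomial with zero gradient is a combination of \<open>p\<close>-th powers of monomials, so that
  \<open>\<Pi>(a\<^sup>p f) = a \<Pi>(f)\<close> leaves only the constants to be compared.
\<close>

lemma cartier_alg_endo:
  fixes f :: "('n, 'k) mpoly"
  assumes "alg_endo \<tau>" and deriv: "\<And>j. partial_deriv j f = 0"
  shows "cartier (\<tau> f) = \<tau> (cartier f)"
proof -
  let ?p = "CHAR('k)"
  have "cartier (\<tau> (Poly_Mapping.single m c)) = \<tau> (cartier (Poly_Mapping.single m c))"
    if m: "m \<in> Poly_Mapping.keys f" for m c
  proof -
    have "m \<in> range (scale_exponent ?p)"
      using keys_dvd_CHAR[OF deriv m] by (simp add: in_range_scale_exponent_iff CHAR_pos)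
    then obtain m' where m': "m = scale_exponent ?p m'" by blast
    define u :: "('n, 'k) mpoly" where "u = Poly_Mapping.single m' 1"
    have "Poly_Mapping.single m c = u ^ ?p * Const c"
      by (simp add: u_def m' single_power Const_def mult_single)
    then have "cartier (\<tau> (Poly_Mapping.single m c)) = cartier (\<tau> u ^ ?p * Const c)"
      by (simp add: alg_endoD[OF assms(1)])
    also have "\<dots> = \<tau> (u * Const (\<pi> c))"
      by (simp add: cartier_power_mult cartier_Const alg_endoD[OF assms(1)])
    also have "u * Const (\<pi> c) = cartier (Poly_Mapping.single m c)"
      by (simp add: m' cartier_single_scale u_def Const_def mult_single)
    finally show ?thesis .
  qed
  then show ?thesis
    by (subst (1 2) poly_mapping_eq_sum_single[of f])
       (simp add: cartier_sum alg_endoD[OF assms(1)])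
qed

end

section \<open>Sets stable under partial derivatives and Cartier operators\<close>

text \<open>
  Induction on the total degree. A nonzero partial derivative has smaller degree. If all of
  them vanish and the polynomial is not constant, then all its exponents are divisible by the
  characteristic \<open>p > 0\<close>, and a Cartier operator that does not kill a chosen coefficient
  divides the degree by at least \<open>p\<close>.
\<close>

lemma ex_Const_in_stable_set:
  fixes S :: "('n::finite, 'k::field) mpoly set"
  assumes "f \<in> S" and "f \<noteq> 0"
    and deriv: "\<And>f j. f \<in> S \<Longrightarrow> partial_deriv j f \<in> S"
    and cartier: "\<And>\<pi> f. \<lbrakk>inverse_frobenius_linear \<pi>; f \<in> S; \<And>j. partial_deriv j f = 0\<rbrakk>
        \<Longrightarrow> inverse_frobenius_linear.cartier \<pi> f \<in> S"
  shows "\<exists>c. c \<noteq> 0 \<and> Const c \<in> S"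
proof -
  define deg :: "('n \<Rightarrow>\<^sub>0 nat) \<Rightarrow> nat" where "deg m = (\<Sum>i\<in>UNIV. Poly_Mapping.lookup m i)" for m
  have deg_0: "m = 0" if "deg m = 0" for m
    using that by (intro poly_mapping_eqI) (simp add: deg_def)
  have deg_unit: "deg (m + Poly_Mapping.single j 1) = Suc (deg m)" for m j
    by (simp add: deg_def lookup_add sum.distrib lookup_single when_def)
  have deg_scale: "deg (scale_exponent p m) = p * deg m" for p m
    by (simp add: deg_def sum_distrib_left)
  have const: "\<exists>c. c \<noteq> 0 \<and> Const c \<in> S"
    if "f \<in> S" "f \<noteq> 0" "\<forall>m\<in>Poly_Mapping.keys f. m = 0" for f
  proof -
    have "f = Const (Poly_Mapping.lookup f 0)"
      by (rule poly_mapping_eqI)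
         (use that in \<open>auto simp: Const_def lookup_single when_def in_keys_iff\<close>)
    with that show ?thesis by (metis Const_def single_zero)
  qed
  have "\<exists>c. c \<noteq> 0 \<and> Const c \<in> S"
    if "f \<in> S" "f \<noteq> 0" "\<forall>m\<in>Poly_Mapping.keys f. deg m \<le> d" for d f
    using that
  proof (induction d arbitrary: f)
    case 0
    then show ?case by (intro const[of f]) (auto intro: deg_0)
  next
    case (Suc d)
    consider j where "partial_deriv j f \<noteq> 0" | "\<forall>m\<in>Poly_Mapping.keys f. m = 0"
      | m where "m \<in> Poly_Mapping.keys f" "m \<noteq> 0" "\<forall>j. partial_deriv j f = 0"
      by blast
    then show ?case
    proof cases
      case 1
      have "deg m \<le> d" if "m \<in> Poly_Mapping.keys (partial_deriv j f)" for m
      proof -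
        have "m + Poly_Mapping.single j 1 \<in> Poly_Mapping.keys f"
          using that by (auto simp: in_keys_iff lookup_partial_deriv)
        with Suc.prems(3) deg_unit[of m j] show ?thesis by fastforce
      qed
      with 1 deriv[OF Suc.prems(1)] show ?thesis by (intro Suc.IH) auto
    next
      case 2
      with Suc.prems show ?thesis by (intro const[of f])
    next
      case 3
      let ?p = "CHAR('k)"
      have dvd: "?p dvd Poly_Mapping.lookup m i" for i
        using keys_dvd_CHAR[of f m i] 3 by blast
      have pos: "?p > 0"
      proof (rule ccontr)
        assume "\<not> ?p > 0"
        with dvd have "m = 0" by (intro poly_mapping_eqI) simp
        with 3 show False by simp
      qed
      from dvd obtain m' where m': "m = scale_exponent ?p m'"
        using in_range_scale_exponent_iff[OF pos, of m] by blast
      have "Poly_Mapping.lookup f m \<noteq> 0" using 3 by (simp add: in_keys_iff)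
      from ex_inverse_frobenius_linear[OF pos this] obtain \<pi> :: "'k \<Rightarrow> 'k"
        where \<pi>: "inverse_frobenius_linear \<pi>" and nz: "\<pi> (Poly_Mapping.lookup f m) \<noteq> 0" .
      interpret inverse_frobenius_linear \<pi> by (rule \<pi>)
      have p2: "?p \<ge> 2"
        using prime_CHAR_semidom[OF pos] by (rule prime_ge_2_nat)
      have "deg k \<le> d" if "k \<in> Poly_Mapping.keys (cartier f)" for k
      proof -
        have "scale_exponent ?p k \<in> Poly_Mapping.keys f"
          using that by (auto simp: in_keys_iff lookup_cartier)
        with Suc.prems(3) have "?p * deg k \<le> Suc d"
          by (auto simp flip: deg_scale)
        moreover have "2 * deg k \<le> ?p * deg k" using p2 by simp
        ultimately show ?thesis by linarith
      qed
      moreover have "cartier f \<noteq> 0"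
      proof
        assume "cartier f = 0"
        then have "Poly_Mapping.lookup (cartier f) m' = 0" by simp
        with nz show False by (simp add: lookup_cartier m')
      qed
      moreover have "cartier f \<in> S"
        using assms(4)[OF \<pi> Suc.prems(1)] 3 by blast
      ultimately show ?thesis by (intro Suc.IH) auto
    qed
  qed
  from this[of f "Max (insert 0 (deg ` Poly_Mapping.keys f))"] show ?thesis
    using assms(1,2) by simp
qed

section \<open>The kernel and the conductor\<close>

lemma kernel_partial_deriv:
  fixes \<tau> :: "('n::finite, 'k::field) mpoly \<Rightarrow> ('n, 'k) mpoly"
  assumes "alg_endo \<tau>" and jac: "jacobian \<tau> = Const c" "c \<noteq> 0" and "\<tau> f = 0"
  shows "\<tau> (partial_deriv i f) = 0"
proof -
  have "Const (inverse c) * (\<tau> (partial_deriv i f) * Const c) = 0"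
    using jacobian_deriv_alg_endo[OF assms(1), of i f] assms(4)
    by (simp add: jac jacobian_deriv_eq_0)
  then show ?thesis by (simp only: Const_inverse_cancel[OF jac(2)])
qed

text \<open>
  A nonzero kernel would contain a nonzero constant, since it is stable under the partial
  derivatives and, on polynomials with zero gradient, under the Cartier operators.
\<close>

lemma inj_of_Const_jacobian:
  fixes \<tau> :: "('n::finite, 'k::field) mpoly \<Rightarrow> ('n, 'k) mpoly"
  assumes "alg_endo \<tau>" and jac: "jacobian \<tau> = Const c" "c \<noteq> 0"
  shows "inj \<tau>"
proof -
  note \<tau> = alg_endoD[OF assms(1)]
  have ker: "f = 0" if "\<tau> f = 0" for f
  proof (rule ccontr)
    assume "f \<noteq> 0"
    with that have "\<exists>a. a \<noteq> 0 \<and> Const a \<in> {f. \<tau> f = 0}"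
    proof (intro ex_Const_in_stable_set)
      fix \<pi> :: "'k \<Rightarrow> 'k" and g
      assume \<pi>: "inverse_frobenius_linear \<pi>" and "g \<in> {f. \<tau> f = 0}"
        and "\<And>j. partial_deriv j g = 0"
      then show "inverse_frobenius_linear.cartier \<pi> g \<in> {f. \<tau> f = 0}"
        using inverse_frobenius_linear.cartier_alg_endo[OF \<pi> assms(1), of g]
        by (simp add: inverse_frobenius_linear.cartier_0[OF \<pi>])
    qed (auto intro: kernel_partial_deriv[OF assms])
    then obtain a where "a \<noteq> 0" "Const a = (0 :: ('n, 'k) mpoly)" by (auto simp: \<tau>)
    then show False by (metis Const_def lookup_single_eq lookup_zero)
  qed
  show ?thesis
  proof (rule injI)
    fix f g assume "\<tau> f = \<tau> g"
    then show "f = g" using ker[of "f - g"] by (simp add: \<tau>)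
  qed
qed

text \<open>
  The conductor of the image of \<open>\<tau>\<close> in the ring, pulled back along \<open>\<tau>\<close>: the degree that
  is lowered below is the degree as a polynomial in the \<open>F\<^sub>i = \<tau> (Var i)\<close>.
\<close>

definition conductor :: "('r::comm_ring_1 \<Rightarrow> 'r) \<Rightarrow> 'r set" where
  "conductor \<tau> = {f. \<forall>a. \<tau> f * a \<in> range \<tau>}"

text \<open>
  Product rule: with \<open>D = \<partial>/\<partial>F\<^sub>i\<close> one has \<open>D(b) a = D(b a) - b D(a)\<close>, and \<open>D\<close> maps the
  image of \<open>\<tau>\<close> to itself.
\<close>

lemma conductor_partial_deriv:
  fixes \<tau> :: "('n::finite, 'k::field) mpoly \<Rightarrow> ('n, 'k) mpoly"
  assumes "alg_endo \<tau>" and jac: "jacobian \<tau> = Const c" "c \<noteq> 0" and f: "f \<in> conductor \<tau>"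
  shows "partial_deriv i f \<in> conductor \<tau>"
  unfolding conductor_def
proof (intro CollectI allI)
  fix a
  note \<tau> = alg_endoD[OF assms(1)]
  note D = jacobian_deriv_alg_endo[OF assms(1), of i, unfolded jac(1)]
  obtain g where g: "\<tau> f * a = \<tau> g" using f by (auto simp: conductor_def)
  obtain h where h: "\<tau> f * jacobian_deriv \<tau> i a = \<tau> h" using f by (auto simp: conductor_def)
  have "\<tau> h + a * (\<tau> (partial_deriv i f) * Const c) = \<tau> (partial_deriv i g) * Const c"
    using jacobian_deriv_mult[of \<tau> i "\<tau> f" a] by (simp only: g D h)
  then have "a * \<tau> (partial_deriv i f) * Const c = \<tau> (partial_deriv i g * Const c - h)"
    by (simp add: \<tau> algebra_simps)
  then have "Const (inverse c) * (a * \<tau> (partial_deriv i f) * Const c) =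
      \<tau> (Const (inverse c) * (partial_deriv i g * Const c - h))"
    by (simp only: \<tau>(2)[of "Const _"] \<tau>(4))
  then have "\<tau> (partial_deriv i f) * a = \<tau> (Const (inverse c) * (partial_deriv i g * Const c - h))"
    by (simp only: Const_inverse_cancel[OF jac(2)] mult.commute[of a])
  then show "\<tau> (partial_deriv i f) * a \<in> range \<tau>" by (rule range_eqI)
qed

text \<open>
  Since \<open>\<Pi>(b) a = \<Pi>(b a\<^sup>p)\<close> for a Cartier operator \<open>\<Pi>\<close>, it suffices that \<open>\<Pi>\<close> maps \<open>b a\<^sup>p\<close>
  into the image of \<open>\<tau>\<close>. Write \<open>b a\<^sup>p = \<tau> g\<close>; the derivations \<open>\<partial>/\<partial>F\<^sub>i\<close> kill both factors, so
  \<open>g\<close> has zero gradient by injectivity, and then \<open>\<Pi> (\<tau> g) = \<tau> (\<Pi> g)\<close>.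
\<close>

lemma conductor_cartier:
  fixes \<tau> :: "('n::finite, 'k::field) mpoly \<Rightarrow> ('n, 'k) mpoly"
  assumes "alg_endo \<tau>" and jac: "jacobian \<tau> = Const c" "c \<noteq> 0" and f: "f \<in> conductor \<tau>"
    and \<pi>: "inverse_frobenius_linear \<pi>" and deriv: "\<And>j. partial_deriv j f = 0"
  shows "inverse_frobenius_linear.cartier \<pi> f \<in> conductor \<tau>"
  unfolding conductor_def
proof (intro CollectI allI)
  fix a
  interpret inverse_frobenius_linear \<pi> by (rule \<pi>)
  note \<tau> = alg_endoD[OF assms(1)]
  note D = jacobian_deriv_alg_endo[OF assms(1), unfolded jac(1)]
  let ?p = "CHAR('k)"
  obtain g where g: "\<tau> f * a ^ ?p = \<tau> g" using f by (auto simp: conductor_def)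
  have "of_nat ?p = (0 :: ('n, 'k) mpoly)" 
    using of_nat_CHAR[where 'a = "('n, 'k) mpoly"] by (simp only: CHAR_mpoly)
  then have power: "jacobian_deriv \<tau> i (a ^ ?p) = 0" for i
    by (intro jacobian_deriv_eq_0) (simp add: partial_deriv_power)
  have "partial_deriv i g = 0" for i
  proof -
    have "\<tau> (partial_deriv i g) * Const c = 0"
      unfolding D[symmetric] g[symmetric] jacobian_deriv_mult power
      by (simp add: D deriv \<tau>)
    then have "Const (inverse c) * (\<tau> (partial_deriv i g) * Const c) = 0" by simp
    then have "\<tau> (partial_deriv i g) = \<tau> 0"
      by (simp only: Const_inverse_cancel[OF jac(2)] \<tau>(5))
    then show ?thesis using inj_of_Const_jacobian[OF assms(1) jac] by (simp add: inj_eq)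
  qed
  then have "cartier (\<tau> g) = \<tau> (cartier g)" by (rule cartier_alg_endo[OF assms(1)])
  moreover have "cartier (\<tau> g) = a * cartier (\<tau> f)"
    unfolding g[symmetric] mult.commute[of "\<tau> f"] by (rule cartier_power_mult)
  moreover have "cartier (\<tau> f) = \<tau> (cartier f)" using deriv by (rule cartier_alg_endo[OF assms(1)])
  ultimately show "\<tau> (cartier f) * a \<in> range \<tau>" by (metis mult.commute rangeI)
qed

text \<open>
  The ideal in the image is nonzero because its annihilator does not contain \<open>1\<close>; any
  preimage of a nonzero element of it lies in the conductor.
\<close>

lemma ex_nonzero_conductor:
  fixes \<tau> :: "'r::comm_ring_1 \<Rightarrow> 'r"
  assumes "ring_endo \<tau>" and "large_image \<tau>"
  shows "\<exists>f\<in>conductor \<tau>. f \<noteq> 0"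
proof -
  obtain L where L: "L \<subseteq> range \<tau>" "left_ideal L" "right_annihilator L = {0}"
    using assms(2) by (auto simp: large_image_def essential_left_ideal_def)
  have "(1::'r) \<notin> right_annihilator L" using L(3) by simp
  then obtain l where l: "l \<in> L" "l \<noteq> 0" by (auto simp: right_annihilator_def)
  then obtain f where f: "l = \<tau> f" using L(1) by blast
  have "\<tau> f * a \<in> range \<tau>" for a
  proof -
    have "a * l \<in> L" using l(1) L(2) by (simp add: left_ideal_def)
    with L(1) show ?thesis by (auto simp: f mult.commute)
  qed
  moreover have "\<tau> 0 = 0"
  proof -
    have "\<tau> (0 + 0) = \<tau> 0 + \<tau> 0" using assms(1) unfolding ring_endo_def by blast
    then show ?thesis by simp
  qed
  ultimately show ?thesis using l(2) f by (auto simp: conductor_def)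
qed

theorem mainTheorem5:
  fixes \<tau> :: "('n::finite, 'k::field) mpoly \<Rightarrow> ('n, 'k) mpoly"
  assumes "alg_endo \<tau>"
    and "large_image \<tau>"
    and "\<exists>c. c \<noteq> 0 \<and> jacobian \<tau> = Const c"
  shows "alg_auto \<tau>"
proof -
  note \<tau> = alg_endoD[OF assms(1)]
  obtain c where c: "jacobian \<tau> = Const c" "c \<noteq> 0" using assms(3) by blast
  have "ring_endo \<tau>" using assms(1) by (simp add: alg_endo_def)
  from ex_nonzero_conductor[OF this assms(2)] obtain f where f: "f \<in> conductor \<tau>" "f \<noteq> 0" by blast
  then have "\<exists>d. d \<noteq> 0 \<and> Const d \<in> conductor \<tau>"
    by (rule ex_Const_in_stable_set)
       (auto intro: conductor_partial_deriv[OF assms(1) c] conductor_cartier[OF assms(1) c])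
  then obtain d where d: "d \<noteq> 0" "Const d \<in> conductor \<tau>" by blast
  have "a \<in> range \<tau>" for a
  proof -
    have "Const d * (Const (inverse d) * a) \<in> range \<tau>"
      using d(2) by (simp add: conductor_def \<tau>)
    also have "Const d * (Const (inverse d) * a) = Const (inverse d) * (a * Const d)"
      by (simp only: mult_ac)
    also have "\<dots> = a" by (rule Const_inverse_cancel[OF d(1)])
    finally show ?thesis .
  qed
  then have "surj \<tau>" by blast
  with inj_of_Const_jacobian[OF assms(1) c] assms(1) show ?thesis
    by (simp add: alg_auto_def bij_def)
qed

end
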